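(* Let $q$ be a prime power, let $n\geq 2$ be an integer and let $\mathcal{C}\subseteq\mathcal{F}_q(n)$ be a full flag code on $\mathbb{F}_q^n$. The number of distance vectors in $\mathcal{D}(d_f(\mathcal{C}),n)$ equals the number of Motzkin paths $p\in\mathcal{M}_n$ such that $A(p)=d_f(\mathcal{C})$, i.e. the value $T(n,d_f(\mathcal{C}))$.
   Context: Let $\mathbb{F}_q$ be the finite field with $q$ elements. A full flag on $\mathbb{F}_q^n$ is a sequence $\mathcal{F}=(\mathcal{F}_1,\dots,\mathcal{F}_{n-1})$ of $\mathbb{F}_q$-subspaces of $\mathbb{F}_q^n$ with $\mathcal{F}_1\subsetneq\cdots\subsetneq\mathcal{F}_{n-1}$ and $\dim \mathcal{F}_i=i$ for every $i$; the set of all full flags is the full flag variety $\mathcal{F}_q(n)$. For subspaces $\mathcal{U},\mathcal{V}$ of the same dimension $k$, the injection distance is $d_I(\mathcal{U},\mathcal{V})=k-\dim(\mathcal{U}\cap\mathcal{V})$. The distance vector of $\mathcal{F},\mathcal{F}'\in\mathcal{F}_q(n)$ is $\mathbf{d}(\mathcal{F},\mathcal{F}')=(d_I(\mathcal{F}_1,\mathcal{F}'_1),\dots,d_I(\mathcal{F}_{n-1},\mathcal{F}'_{n-1}))\in\mathbb{Z}^{n-1}$; the flag distance $d_f(\mathcal{F},\mathcal{F}')=\sum_{i=1}^{n-1} d_I(\mathcal{F}_i,\mathcal{F}'_i)$ is the sum of its components. Put $\mathcal{D}(d,n)=\{\mathbf{d}(\mathcal{F},\mathcal{F}') \mid \mathcal{F},\mathcal{F}'\in\mathcal{F}_q(n),\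 d_f(\mathcal{F},\mathcal{F}')=d\}$ (pairs with $\mathcal{F}=\mathcal{F}'$ are allowed). A full flag code on $\mathbb{F}_q^n$ is a nonempty subset $\mathcal{C}\subseteq\mathcal{F}_q(n)$. Its minimum distance is $d_f(\mathcal{C})=\min\{d_f(\mathcal{F},\mathcal{F}')\mid \mathcal{F},\mathcal{F}'\in\mathcal{C},\ \mathcal{F}\neq\mathcal{F}'\}$ if $|\mathcal{C}|\geq 2$, and $d_f(\mathcal{C})=0$ if $|\mathcal{C}|=1$. A Motzkin path of length $n$ is a lattice path in $\mathbb{Z}^2$ from $(0,0)$ to $(n,0)$ with steps $U=(1,1)$, $D=(1,-1)$, $H=(1,0)$ that never runs below the $x$-axis; $\mathcal{M}_n$ is the set of these. The area $A(p)$ of a Motzkin path $p$ is the area of the region above the $x$-axis and below $p$. $T(n,k)$ denotes the number of Motzkin paths of length $n$ and area $k$. *)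

theory Defs
  imports "HOL-Analysis.Analysis"
begin

section \<open>Full flags on a finite coordinate space\<close>

text \<open>
  The field with \<open>q\<close> elements is a type \<open>'a\<close> of class \<open>{field, finite}\<close>, so that \<open>q = CARD('a)\<close>, and
  its \<open>n\<close>-dimensional coordinate space is \<open>'a ^ 'n\<close> with \<open>n = CARD('n)\<close>.
  A full flag is the list of its \<open>n - 1\<close> subspaces; lists are indexed from \<open>0\<close>, so the entry at
  position \<open>i\<close> has dimension \<open>i + 1\<close>.
\<close>

definition full_flags :: "('a::{field,finite} ^ 'n) set list set" where
  "full_flags = {F. length F = CARD('n) - 1
                  \<and> (\<forall>i<length F. vec.subspace (F ! i) \<and> vec.dim (F ! i) = i + 1)
                  \<and> sorted_wrt (\<subset>) F}"

text \<open>Only meaningful for subspaces \<open>U\<close>, \<open>V\<close> of equal dimension.\<close>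

definition injection_dist :: "('a::{field,finite} ^ 'n) set \<Rightarrow> ('a ^ 'n) set \<Rightarrow> int" where
  "injection_dist U V = int (vec.dim U) - int (vec.dim (U \<inter> V))"

definition distance_vector ::
    "('a::{field,finite} ^ 'n) set list \<Rightarrow> ('a ^ 'n) set list \<Rightarrow> int list" where
  "distance_vector F F' = map2 injection_dist F F'"

definition flag_dist ::
    "('a::{field,finite} ^ 'n) set list \<Rightarrow> ('a ^ 'n) set list \<Rightarrow> int" where
  "flag_dist F F' = sum_list (distance_vector F F')"

text \<open>The type argument supplies the ambient space, which does not occur in the result type.\<close>

definition distance_vectors :: "('a::{field,finite} ^ 'n) itself \<Rightarrow> int \<Rightarrow> int list set" where
  "distance_vectors _ d =
     {distance_vector F F' | F F' :: ('a ^ 'n) set list.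
        F \<in> full_flags \<and> F' \<in> full_flags \<and> flag_dist F F' = d}"

definition full_flag_code :: "('a::{field,finite} ^ 'n) set list set \<Rightarrow> bool" where
  "full_flag_code C \<longleftrightarrow> C \<noteq> {} \<and> C \<subseteq> full_flags"

definition min_dist :: "('a::{field,finite} ^ 'n) set list set \<Rightarrow> int" where
  "min_dist C = (if card C \<ge> 2
     then Min {flag_dist F F' | F F'. F \<in> C \<and> F' \<in> C \<and> F \<noteq> F'}
     else 0)"


section \<open>Motzkin paths\<close>

text \<open>
  A lattice path starting at the origin is given by the list of its steps, as vectors;
  \<open>path_vertex p i\<close> is the lattice point reached after the first \<open>i\<close> steps.
\<close>

definition path_vertex :: "(int \<times> int) list \<Rightarrow> nat \<Rightarrow> int \<times> int" where
  "path_vertex p i = sum_list (take i p)"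

definition motzkin_paths :: "nat \<Rightarrow> (int \<times> int) list set" where
  "motzkin_paths n = {p. set p \<subseteq> {(1, 1), (1, -1), (1, 0)}
                       \<and> path_vertex p (length p) = (int n, 0)
                       \<and> (\<forall>i\<le>length p. 0 \<le> snd (path_vertex p i))}"

definition path_trace :: "(int \<times> int) list \<Rightarrow> (real \<times> real) set" where
  "path_trace p = (\<Union>i<length p.
     closed_segment (map_prod real_of_int real_of_int (path_vertex p i))
                    (map_prod real_of_int real_of_int (path_vertex p (i + 1))))"

definition path_area :: "(int \<times> int) list \<Rightarrow> real" where
  "path_area p = measure lborel {(x, y). 0 \<le> y \<and> (\<exists>y'. (x, y') \<in> path_trace p \<and> y \<le> y')}"

definition motzkin_area_count :: "nat \<Rightarrow> int \<Rightarrow> nat" where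
  "motzkin_area_count n k = card {p \<in> motzkin_paths n. path_area p = real_of_int k}"

end

theory Submission
  imports Defs
begin

text \<open>
  The vector of interior heights determines a Motzkin path, and by the trapezoidal rule its sum is
  the area. A distance vector is such a vector of heights, since passing from
  \<open>F\<^sub>i \<inter> F'\<^sub>i\<close> to \<open>F\<^sub>i\<^sub>+\<^sub>1 \<inter> F'\<^sub>i\<^sub>+\<^sub>1\<close> raises the dimension by
  0, 1 or 2. Conversely, every Motzkin path is realised by two flags of coordinate subspaces, for
  which only the sizes of the intersections of two chains of index sets have to be prescribed.
\<close>

section \<open>Motzkin paths and their heights\<close>

text \<open>A Motzkin path has height 0 at both ends, so only interior vertices are kept:
  \<open>n - 1\<close> entries, as in a distance vector.\<close>

definition path_heights :: "(int \<times> int) list \<Rightarrow> int list" where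
  "path_heights p = map (\<lambda>i. snd (path_vertex p i)) [1..<length p]"

lemma path_vertex_0 [simp]: "path_vertex p 0 = 0"
  by (simp add: path_vertex_def)

lemma path_vertex_Suc: "i < length p \<Longrightarrow> path_vertex p (Suc i) = path_vertex p i + p ! i"
  by (simp add: path_vertex_def take_Suc_conv_app_nth)

lemma fst_path_vertex:
  assumes "set p \<subseteq> {(1, 1), (1, -1), (1, 0)}" "i \<le> length p"
  shows "fst (path_vertex p i) = int i"
  using assms(2)
proof (induction i)
  case (Suc i)
  then have "p ! i \<in> set p" by simp
  then have "p ! i \<in> {(1, 1), (1, -1), (1, 0)}" using assms(1) by blast
  with Suc show ?case by (auto simp: path_vertex_Suc)
qed simp

text \<open>\<open>motzkin_paths\<close> fixes only the end point. Since every step advances the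
  abscissa by one, the number of steps is recovered from it.\<close>

lemma motzkin_path_length: "p \<in> motzkin_paths n \<Longrightarrow> length p = n"
  using fst_path_vertex[of p "length p"] by (simp add: motzkin_paths_def)

lemma motzkin_path_vertex:
  assumes "p \<in> motzkin_paths n" "i \<le> n"
  shows "path_vertex p i = (int i, snd (path_vertex p i))"
proof -
  have "fst (path_vertex p i) = int i"
    using assms motzkin_path_length[OF assms(1)]
    by (intro fst_path_vertex) (auto simp: motzkin_paths_def)
  then show ?thesis by (metis prod.collapse)
qed

lemma motzkin_path_end:
  assumes "p \<in> motzkin_paths n"
  shows "snd (path_vertex p n) = 0"
  using assms motzkin_path_length[OF assms] by (auto simp: motzkin_paths_def)

lemma motzkin_path_nonneg:
  assumes "p \<in> motzkin_paths n" "i \<le> n"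
  shows "0 \<le> snd (path_vertex p i)"
  using assms motzkin_path_length[OF assms(1)] by (auto simp: motzkin_paths_def)

lemma motzkin_path_step:
  assumes "p \<in> motzkin_paths n" "i < n"
  shows "snd (path_vertex p (Suc i)) - snd (path_vertex p i) \<in> {-1, 0, 1}"
proof -
  have "p ! i \<in> {(1, 1), (1, -1), (1, 0)}"
    using assms(2) motzkin_path_length[OF assms(1)] assms(1) nth_mem[of i p]
    unfolding motzkin_paths_def by blast
  then show ?thesis
    using assms motzkin_path_length[OF assms(1)] by (auto simp: path_vertex_Suc)
qed

lemma motzkin_path_of_heights:
  fixes h :: "nat \<Rightarrow> int"
  assumes "h 0 = 0" "h n = 0" "\<And>i. i \<le> n \<Longrightarrow> 0 \<le> h i"
    and step: "\<And>i. i < n \<Longrightarrow> h (Suc i) - h i \<in> {-1, 0, 1}"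
  obtains p where "p \<in> motzkin_paths n" "path_heights p = map h [1..<n]"
proof -
  \<comment> \<open>The steps are forced: one unit to the right, and the increment of
    \<open>h\<close>; the vertices then telescope to \<open>(i, h i)\<close>.\<close>
  define p where "p = map (\<lambda>i. (1 :: int, h (Suc i) - h i)) [0..<n]"
  have len: "length p = n" by (simp add: p_def)
  have vertex: "path_vertex p i = (int i, h i)" if "i \<le> n" for i
    using that
  proof (induction i)
    case 0
    then show ?case by (simp add: assms(1) zero_prod_def)
  next
    case (Suc i)
    then show ?case using path_vertex_Suc[of i p] by (simp add: len p_def)
  qed
  have "set p \<subseteq> {(1, 1), (1, -1), (1, 0)}"
    using step by (fastforce simp: p_def)
  then have "p \<in> motzkin_paths n"
    using assms(2,3) by (simp add: motzkin_paths_def len vertex)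
  moreover have "path_heights p = map h [1..<n]"
    by (auto simp: path_heights_def len vertex)
  ultimately show thesis by (rule that)
qed

text \<open>Abscissas are the indices and the end heights are 0, so the interior heights fix all
  vertices, and steps are differences of consecutive vertices.\<close>

lemma inj_on_path_heights: "inj_on path_heights (motzkin_paths n)"
proof (rule inj_onI)
  fix p p' assume p: "p \<in> motzkin_paths n" "p' \<in> motzkin_paths n" 
    and eq: "path_heights p = path_heights p'"
  note len = motzkin_path_length[OF p(1)] motzkin_path_length[OF p(2)]
  have inner: "snd (path_vertex p i) = snd (path_vertex p' i)" if "1 \<le> i" "i < n" for i
    using eq that by (auto simp: path_heights_def len)
  have vertex: "path_vertex p i = path_vertex p' i" if "i \<le> n" for i
  proof -
    have "snd (path_vertex p i) = snd (path_vertex p' i)"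
      using inner[of i] motzkin_path_end[OF p(1)] motzkin_path_end[OF p(2)] that
      by (cases "i = 0"; cases "i = n") auto
    then show ?thesis
      using motzkin_path_vertex[OF p(1) that] motzkin_path_vertex[OF p(2) that] by metis
  qed
  show "p = p'"
  proof (rule nth_equalityI)
    fix i assume "i < length p"
    then have i: "i < length p" "i < length p'" "i \<le> n" "Suc i \<le> n" using len by auto
    show "p ! i = p' ! i"
      using path_vertex_Suc[OF i(1)] path_vertex_Suc[OF i(2)] vertex[OF i(3)] vertex[OF i(4)]
      by simp
  qed (simp add: len)
qed

section \<open>The area below a Motzkin path\<close>

text \<open>This is the region between the x-axis and the segment from \<open>(c, a)\<close> to
  \<open>(c + 1, b)\<close>, written so that each vertical slice is an interval.\<close>

definition trapezoid :: "real \<Rightarrow> real \<Rightarrow> real \<Rightarrow> (real \<times> real) set" where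
  "trapezoid c a b = {(x, y). c \<le> x \<and> x \<le> c + 1 \<and> 0 \<le> y \<and> y \<le> a + (x - c) * (b - a)}"

lemma trapezoid_borel: "trapezoid c a b \<in> sets borel"
proof -
  have "closed (trapezoid c a b)"
    unfolding trapezoid_def case_prod_beta
    by (intro closed_Collect_conj closed_Collect_le continuous_intros)
  then show ?thesis by simp
qed

lemma emeasure_trapezoid:
  assumes "0 \<le> a" "0 \<le> b"
  shows "emeasure lborel (trapezoid c a b) = ennreal ((a + b) / 2)"
proof -
  \<comment> \<open>An antiderivative of the slice length
    \<open>a + (x - c) * (b - a)\<close>.\<close>
  define F where "F x = a * x + (b - a) * (x - c)\<^sup>2 / 2" for x
  have pos: "0 \<le> a + (x - c) * (b - a)" if "c \<le> x" "x \<le> c + 1" for x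
  proof -
    \<comment> \<open>The slice length is a convex combination of \<open>a\<close> and
      \<open>b\<close>.\<close>
    have "a + (x - c) * (b - a) = (c + 1 - x) * a + (x - c) * b" by (simp add: algebra_simps)
    then show ?thesis using assms that by simp
  qed
  have slice: "emeasure lborel (Pair x -` trapezoid c a b)
      = ennreal (a + (x - c) * (b - a)) * indicator {c..c + 1} x" for x
  proof (cases "x \<in> {c..c + 1}")
    case True
    then have "Pair x -` trapezoid c a b = {0..a + (x - c) * (b - a)}"
      by (auto simp: trapezoid_def)
    then show ?thesis using True pos[of x] by simp
  next
    case False
    then have "Pair x -` trapezoid c a b = {}" by (auto simp: trapezoid_def)
    then show ?thesis using False by simp
  qed
  have "emeasure lborel (trapezoid c a b) = emeasure (lborel \<Otimes>\<^sub>M lborel) (trapezoid c a b)"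
    by (simp add: lborel_prod)
  also have "\<dots> = (\<integral>\<^sup>+x. emeasure lborel (Pair x -` trapezoid c a b) \<partial>lborel)"
    by (intro lborel.emeasure_pair_measure_alt)
       (metis lborel_prod sets_lborel trapezoid_borel)
  also have "\<dots> = (\<integral>\<^sup>+x. ennreal (a + (x - c) * (b - a)) * indicator {c..c + 1} x \<partial>lborel)"
    by (simp add: slice)
  also have "\<dots> = ennreal (F (c + 1) - F c)"
  proof (rule nn_integral_FTC_Icc)
    show "(F has_real_derivative a + (x - c) * (b - a)) (at x)" for x
      unfolding F_def by (auto intro!: derivative_eq_intros)
  qed (use pos in auto)
  also have "F (c + 1) - F c = (a + b) / 2" by (simp add: F_def field_simps)
  finally show ?thesis .
qed

text \<open>Restated for \<open>lebesgue\<close>, the measure for which additivity up to negligible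
  overlaps is applied below.\<close>

lemma measure_trapezoid:
  assumes "0 \<le> a" "0 \<le> b"
  shows "trapezoid c a b \<in> lmeasurable" "measure lebesgue (trapezoid c a b) = (a + b) / 2"
proof -
  have "emeasure lebesgue (trapezoid c a b) = ennreal ((a + b) / 2)"
    using emeasure_trapezoid[OF assms] trapezoid_borel by simp
  then show "trapezoid c a b \<in> lmeasurable" "measure lebesgue (trapezoid c a b) = (a + b) / 2"
    using assms trapezoid_borel by (auto simp: fmeasurable_def measure_def)
qed

text \<open>A common point satisfies x \<le> i + 1 \<le> j \<le> x, so the overlap lies on the
  vertical line at \<open>j\<close>.\<close>

lemma negligible_trapezoid_Int:
  assumes "i < j"
  shows "negligible (trapezoid (real i) a b \<inter> trapezoid (real j) a' b')"
proof (rule negligible_subset)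
  show "negligible {z :: real \<times> real. z \<bullet> (1, 0) = real j}"
    by (rule negligible_standard_hyperplane) (simp add: Basis_prod_def)
  have "real i + 1 \<le> real j" using assms by simp
  then show "trapezoid (real i) a b \<inter> trapezoid (real j) a' b' \<subseteq> {z. z \<bullet> (1, 0) = real j}"
    by (auto simp: trapezoid_def inner_prod_def)
qed

lemma mem_segment_unit_step:
  "(x, y) \<in> closed_segment (c, a) (c + 1, b) \<longleftrightarrow> c \<le> x \<and> x \<le> c + 1 \<and> y = a + (x - c) * (b - a)"
  for c :: real
proof
  assume "(x, y) \<in> closed_segment (c, a) (c + 1, b)"
  then obtain u where "0 \<le> u" "u \<le> 1" "x = (1 - u) * c + u * (c + 1)" "y = (1 - u) * a + u * b"
    by (auto simp: in_segment)
  then show "c \<le> x \<and> x \<le> c + 1 \<and> y = a + (x - c) * (b - a)"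
    by (auto simp: algebra_simps)
next
  assume "c \<le> x \<and> x \<le> c + 1 \<and> y = a + (x - c) * (b - a)"
  then show "(x, y) \<in> closed_segment (c, a) (c + 1, b)"
    by (auto simp: in_segment algebra_simps intro!: exI[of _ "x - c"])
qed

lemma path_area_eq_sum_heights:
  assumes p: "p \<in> motzkin_paths n"
  shows "path_area p = real_of_int (sum_list (path_heights p))"
proof -
  define h where "h i = real_of_int (snd (path_vertex p i))" for i
  note len = motzkin_path_length[OF p]
  define T where "T i = trapezoid (real i) (h i) (h (Suc i))" for i
  have h: "0 \<le> h i" if "i \<le> n" for i
    using motzkin_path_nonneg[OF p that] by (simp add: h_def)
  have vertex: "map_prod real_of_int real_of_int (path_vertex p i) = (real i, h i)" if "i \<le> n" for i
    by (subst motzkin_path_vertex[OF p that]) (simp add: h_def)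
  have "path_trace p = (\<Union>i<n. closed_segment (real i, h i) (real i + 1, h (Suc i)))"
    unfolding path_trace_def len using vertex
    by (intro SUP_cong refl) (simp add: add.commute)
  \<comment> \<open>Over its unit interval each segment is the graph of an affine function, so the
    region below it is one trapezoid.\<close>
  then have "{(x, y). 0 \<le> y \<and> (\<exists>y'. (x, y') \<in> path_trace p \<and> y \<le> y')} = (\<Union>i<n. T i)"
    by (auto simp: mem_segment_unit_step T_def trapezoid_def)
  then have "path_area p = measure lebesgue (\<Union>i<n. T i)"
    by (simp add: path_area_def T_def trapezoid_borel sets.finite_UN)
  also have "\<dots> = (\<Sum>i<n. measure lebesgue (T i))"
  proof (rule measure_negligible_finite_Union_image)
    show "pairwise (\<lambda>i j. negligible (T i \<inter> T j)) {..<n}"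
      unfolding pairwise_def T_def
      by (metis Int_commute linorder_neqE_nat negligible_trapezoid_Int)
  qed (auto simp: T_def measure_trapezoid h)
  also have "\<dots> = (\<Sum>i<n. (h i + h (Suc i)) / 2)"
    by (intro sum.cong refl) (simp add: T_def measure_trapezoid h)
  \<comment> \<open>Each height occurs in two adjacent trapezoids; shifting the index costs only
    \<open>h n - h 0\<close>, which is 0.\<close>
  also have "\<dots> = (\<Sum>i<n. h i)"
  proof -
    have "(\<Sum>i<n. h (Suc i)) = (\<Sum>i<n. h i) + h n - h 0"
      using sum.lessThan_Suc[of h n] sum.lessThan_Suc_shift[of h n] by simp
    moreover have "h n = 0" "h 0 = 0"
      using motzkin_path_end[OF p] by (auto simp: h_def)
    ultimately show ?thesis
      by (simp add: sum_divide_distrib[symmetric] sum.distrib)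
  qed
  also have "\<dots> = (\<Sum>i=1..<n. h i)"
    by (rule sum.mono_neutral_right) (auto simp: h_def Suc_le_eq)
  also have "\<dots> = real_of_int (sum_list (path_heights p))"
    by (simp add: path_heights_def len h_def sum_list_distinct_conv_sum_set)
  finally show ?thesis .
qed

section \<open>Distance vectors of full flags are height vectors\<close>

text \<open>Padding the flag with the zero space and the whole space makes the index equal the
  dimension for all indices from 0 to \<open>n\<close>, which gives the path its two end
  points.\<close>

definition flag_space :: "('a::{field,finite} ^ 'n) set list \<Rightarrow> nat \<Rightarrow> ('a ^ 'n) set" where
  "flag_space F i = (if i = 0 then {0} else if i = CARD('n) then UNIV else F ! (i - 1))"

lemma flag_space:
  fixes F :: "('a::{field,finite} ^ 'n) set list"
  assumes "F \<in> full_flags" "i \<le> CARD('n)"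
  shows "vec.subspace (flag_space F i)" "vec.dim (flag_space F i) = i"
  using assms by (auto simp: full_flags_def flag_space_def vec.dim_eq_0 card_cart_basis)

lemma flag_space_Suc:
  fixes F :: "('a::{field,finite} ^ 'n) set list"
  assumes "F \<in> full_flags" "i < CARD('n)"
  shows "flag_space F i \<subseteq> flag_space F (Suc i)"
proof (cases "i = 0 \<or> Suc i = CARD('n)")
  case True
  then show ?thesis
    using flag_space(1)[of F "Suc i"] assms vec.subspace_0
    by (auto simp: flag_space_def)
next
  case False
  then have "F ! (i - 1) \<subset> F ! i"
    using assms by (intro sorted_wrt_nth_less[of "(\<subset>)"]) (auto simp: full_flags_def)
  then show ?thesis using False assms(2) by (auto simp: flag_space_def)
qed

text \<open>The sum of \<open>V \<inter> W\<close> and \<open>U\<close> lies in \<open>V\<close>,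
  and these two meet in \<open>U \<inter> W\<close>; the dimension formula for sums gives the
  bound.\<close>

lemma dim_Int_le:
  fixes U V W :: "('a::field ^ 'n) set"
  assumes "vec.subspace U" "vec.subspace V" "vec.subspace W" "U \<subseteq> V"
  shows "vec.dim (V \<inter> W) + vec.dim U \<le> vec.dim V + vec.dim (U \<inter> W)"
proof -
  let ?S = "{x + y |x y. x \<in> V \<inter> W \<and> y \<in> U}"
  have "vec.dim ?S + vec.dim (V \<inter> W \<inter> U) = vec.dim (V \<inter> W) + vec.dim U"
    using assms by (intro vec.dim_sums_Int vec.subspace_inter)
  moreover have "V \<inter> W \<inter> U = U \<inter> W" using assms(4) by auto
  moreover have "vec.dim ?S \<le> vec.dim V"
    using assms by (intro vec.dim_subset) (auto intro: vec.subspace_add)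
  ultimately show ?thesis by simp
qed

lemma motzkin_path_of_flags:
  fixes F F' :: "('a::{field,finite} ^ 'n) set list"
  assumes F: "F \<in> full_flags" and F': "F' \<in> full_flags"
  obtains p where "p \<in> motzkin_paths CARD('n)" "path_heights p = distance_vector F F'"
proof -
  let ?n = "CARD('n)"
  define h where "h i = int i - int (vec.dim (flag_space F i \<inter> flag_space F' i))" for i
  have h0: "h 0 = 0" by (simp add: h_def flag_space_def)
  have hn: "h ?n = 0" by (simp add: h_def flag_space_def card_cart_basis)
  have h_nonneg: "0 \<le> h i" if "i \<le> ?n" for i
    using vec.dim_subset[of "flag_space F i \<inter> flag_space F' i" "flag_space F i"]
      flag_space(2)[OF F that] by (simp add: h_def)
  have step: "h (Suc i) - h i \<in> {-1, 0, 1}" if i: "i < ?n" for i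
  proof -
    let ?U = "flag_space F i" and ?V = "flag_space F (Suc i)"
      and ?U' = "flag_space F' i" and ?V' = "flag_space F' (Suc i)"
    note sub = flag_space_Suc[OF F i] flag_space_Suc[OF F' i]
    have le: "i \<le> ?n" "Suc i \<le> ?n" using i by auto
    note sp = flag_space[OF F le(1)] flag_space[OF F le(2)]
      flag_space[OF F' le(1)] flag_space[OF F' le(2)]
    \<comment> \<open>The passage goes through the mixed intersection
      \<open>?U \<inter> ?V'\<close>: each of its two stages adds at most 1, so the total gain is 0,
      1 or 2 and the height changes by 1 minus that gain.\<close>
    have "vec.dim (?U \<inter> ?U') \<le> vec.dim (?V \<inter> ?V')"
      using sub by (intro vec.dim_subset) auto
    moreover have "vec.dim (?V \<inter> ?V') \<le> vec.dim (?U \<inter> ?V') + 1"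
      using dim_Int_le[of ?U ?V ?V'] sub sp by simp
    moreover have "vec.dim (?U \<inter> ?V') \<le> vec.dim (?U \<inter> ?U') + 1"
      using dim_Int_le[of ?U' ?V' ?U] sub sp by (simp add: Int_commute)
    ultimately show ?thesis by (auto simp: h_def)
  qed
  obtain p where p: "p \<in> motzkin_paths ?n" "path_heights p = map h [1..<?n]"
    using motzkin_path_of_heights[OF h0 hn h_nonneg step] by blast
  moreover have "map h [1..<?n] = distance_vector F F'"
    using F F'
    by (intro nth_equalityI)
       (auto simp: distance_vector_def injection_dist_def h_def flag_space_def full_flags_def)
  ultimately show thesis using that by simp
qed

section \<open>Every height vector is a distance vector\<close>

text \<open>Both lists grow together, one element at a time, and all prefix intersections keep the
  prescribed size. Prefixes of length \<open>i\<close> have a union of size \<open>i + h i\<close>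
  and differences of size \<open>h i\<close>, so \<open>bound\<close> says that the union fits into
  the index type and \<open>pos\<close> that down steps have elements to use.\<close>

lemma ex_lists_card_Int:
  fixes h :: "nat \<Rightarrow> int"
  assumes h0: "h 0 = 0"
    and pos: "\<And>i. i \<le> CARD('n) \<Longrightarrow> 0 \<le> h i"
    and bound: "\<And>i. i \<le> CARD('n) \<Longrightarrow> int i + h i \<le> int CARD('n)"
    and step: "\<And>i. i < CARD('n) \<Longrightarrow> h (Suc i) - h i \<in> {-1, 0, 1}"
  shows "k \<le> CARD('n) \<Longrightarrow> \<exists>xs ys :: 'n::finite list. length xs = k \<and> length ys = k
    \<and> distinct xs \<and> distinct ys
    \<and> (\<forall>i\<le>k. int (card (set (take i xs) \<inter> set (take i ys))) = int i - h i)"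
proof (induction k)
  case 0
  then show ?case by (simp add: h0)
next
  case (Suc k)
  then obtain xs ys :: "'n list" where len: "length xs = k" "length ys = k"
    and dist: "distinct xs" "distinct ys"
    and IH: "\<And>i. i \<le> k \<Longrightarrow> int (card (set (take i xs) \<inter> set (take i ys))) = int i - h i"
    by auto
  have card: "card (set xs) = k" "card (set ys) = k"
    using dist len by (auto simp: distinct_card)
  have card_Int: "int (card (set xs \<inter> set ys)) = int k - h k"
    using IH[of k] len by simp
  then have card_Un: "int (card (set xs \<union> set ys)) = int k + h k"
    using card_Un_Int[of "set xs" "set ys"] card by simp
  have card_Diff: "int (card (set xs - set ys)) = h k" "int (card (set ys - set xs)) = h k"
    using card_Diff_subset_Int[of "set xs" "set ys"] card_Diff_subset_Int[of "set ys" "set xs"]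
      card card_Int card_mono[of "set xs" "set xs \<inter> set ys"]
    by (auto simp: Int_commute)
  \<comment> \<open>An up step appends two different fresh elements, a level step the same fresh element to both
    lists, a down step to each list an element that so far occurs only in the other.\<close>
  have "\<exists>x y. x \<notin> set xs \<and> y \<notin> set ys
     \<and> int (card (insert x (set xs) \<inter> insert y (set ys))) = int (Suc k) - h (Suc k)"
  proof -
    have "h (Suc k) - h k \<in> {-1, 0, 1}" using step[of k] Suc.prems by simp
    then consider "h (Suc k) = h k + 1" | "h (Suc k) = h k" | "h (Suc k) = h k - 1" by auto
    then show ?thesis
    proof cases
      case 1
      \<comment> \<open>Here \<open>Suc k + h (Suc k)\<close> is \<open>k + h k + 2\<close>, so the
        bound leaves two elements outside the union.\<close>
      then have "2 \<le> card (- (set xs \<union> set ys))"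
        using bound[OF Suc.prems] card_Un card_Diff_subset[of "set xs \<union> set ys" UNIV]
        by (simp add: Compl_eq_Diff_UNIV)
      then obtain x y where "x \<noteq> y" "x \<notin> set xs \<union> set ys" "y \<notin> set xs \<union> set ys"
        using card_le_Suc0_iff_eq[of "- (set xs \<union> set ys)"] by fastforce
      moreover from this have "insert x (set xs) \<inter> insert y (set ys) = set xs \<inter> set ys" by auto
      ultimately show ?thesis using card_Int 1 by (intro exI[of _ x] exI[of _ y]) simp
    next
      case 2
      then have "card (set xs \<union> set ys) < CARD('n)"
        using bound[OF Suc.prems] card_Un by linarith
      then have "set xs \<union> set ys \<noteq> UNIV" by (metis less_irrefl)
      then obtain x where "x \<notin> set xs \<union> set ys" by auto
      then show ?thesis using card_Int 2 by (intro exI[of _ x]) simp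
    next
      case 3
      then have "card (set xs - set ys) \<noteq> 0" "card (set ys - set xs) \<noteq> 0"
        using pos[OF Suc.prems] card_Diff by linarith+
      then have "set xs - set ys \<noteq> {}" "set ys - set xs \<noteq> {}"
        by (metis card.empty)+
      then obtain x y where xy: "y \<in> set xs - set ys" "x \<in> set ys - set xs" by auto
      \<comment> \<open>The choice is crosswise: \<open>x\<close> comes from \<open>ys\<close> and
        \<open>y\<close> from \<open>xs\<close>, so both enter the intersection, which grows by
        2.\<close>
      then have "insert x (set xs) \<inter> insert y (set ys) = insert x (insert y (set xs \<inter> set ys))"
        "x \<noteq> y" by auto
      then show ?thesis using card_Int 3 xy by (intro exI[of _ x] exI[of _ y]) simp
    qed
  qed
  then obtain x y where xy: "x \<notin> set xs" "y \<notin> set ys"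
    "int (card (insert x (set xs) \<inter> insert y (set ys))) = int (Suc k) - h (Suc k)" by auto
  have "int (card (set (take i (xs @ [x])) \<inter> set (take i (ys @ [y])))) = int i - h i"
    if "i \<le> Suc k" for i
    using IH[of i] xy(3) len that by (cases "i = Suc k") auto
  then show ?case
    using len dist xy by (intro exI[of _ "xs @ [x]"] exI[of _ "ys @ [y]"]) simp
qed

section \<open>Flags of coordinate subspaces\<close>

definition coordinate_space :: "'n set \<Rightarrow> ('a::field ^ 'n) set" where
  "coordinate_space S = {x. \<forall>i. i \<notin> S \<longrightarrow> x $ i = 0}"

lemma subspace_coordinate_space: "vec.subspace (coordinate_space S)"
  unfolding coordinate_space_def by (rule subspace_substandard_cart)

lemma dim_coordinate_space: "vec.dim (coordinate_space S) = card S"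
  unfolding coordinate_space_def by (rule dim_substandard_cart)

text \<open>Together with the dimension formula above, this turns injection distances into
  cardinalities of intersections of index sets.\<close>

lemma coordinate_space_Int:
  "coordinate_space S \<inter> coordinate_space T = coordinate_space (S \<inter> T)"
  by (auto simp: coordinate_space_def)

text \<open>The empty and the full prefix are left out, since a flag lists only the proper nonzero
  subspaces.\<close>

definition coordinate_flag :: "'n list \<Rightarrow> ('a::{field,finite} ^ 'n) set list" where
  "coordinate_flag xs = map (\<lambda>i. coordinate_space (set (take i xs))) [1..<length xs]"

lemma coordinate_flag_mem:
  fixes xs :: "'n::finite list"
  assumes "distinct xs" "length xs = CARD('n)"
  shows "(coordinate_flag xs :: ('a::{field,finite} ^ 'n) set list) \<in> full_flags"
proof -
  have dim: "vec.dim (coordinate_space (set (take i xs)) :: ('a ^ 'n) set) = i"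
    if "i \<le> CARD('n)" for i
    using that assms by (simp add: dim_coordinate_space distinct_card)
  have "coordinate_space (set (take i xs)) \<subset> (coordinate_space (set (take j xs)) :: ('a ^ 'n) set)"
    if "i < j" "j \<le> CARD('n)" for i j
  proof
    show "coordinate_space (set (take i xs)) \<subseteq> (coordinate_space (set (take j xs)) :: ('a ^ 'n) set)"
      using set_take_subset_set_take[of i j xs] that by (auto simp: coordinate_space_def)
    show "coordinate_space (set (take i xs)) \<noteq> (coordinate_space (set (take j xs)) :: ('a ^ 'n) set)"
      using dim[of i] dim[of j] that by auto
  qed
  then have "sorted_wrt (\<subset>) (coordinate_flag xs :: ('a ^ 'n) set list)"
    by (auto simp: coordinate_flag_def sorted_wrt_iff_nth_less assms(2))
  then show ?thesis
    using dim by (auto simp: full_flags_def coordinate_flag_def assms(2) subspace_coordinate_space)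
qed

text \<open>The path has to be back at height 0 after \<open>n\<close> steps and falls by at most 1
  per step, hence the downward induction from \<open>n\<close>. This supplies the hypothesis
  \<open>bound\<close> of \<open>ex_lists_card_Int\<close>.\<close>

lemma motzkin_path_height_le:
  assumes "p \<in> motzkin_paths n" "i \<le> n"
  shows "int i + snd (path_vertex p i) \<le> int n"
  using assms(2)
proof (induction rule: inc_induct)
  case base
  then show ?case using motzkin_path_end[OF assms(1)] by simp
next
  case (step i)
  then show ?case using motzkin_path_step[OF assms(1), of i] by auto
qed

lemma flags_of_motzkin_path:
  assumes p: "p \<in> motzkin_paths CARD('n)"
  obtains F F' :: "('a::{field,finite} ^ 'n) set list"
  where "F \<in> full_flags" "F' \<in> full_flags" "distance_vector F F' = path_heights p"
proof -
  have "\<exists>xs ys :: 'n list. length xs = CARD('n) \<and> length ys = CARD('n)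
    \<and> distinct xs \<and> distinct ys
    \<and> (\<forall>i\<le>CARD('n). int (card (set (take i xs) \<inter> set (take i ys)))
          = int i - snd (path_vertex p i))"
    using motzkin_path_nonneg[OF p] motzkin_path_height_le[OF p] motzkin_path_step[OF p]
    by (intro ex_lists_card_Int) auto
  then obtain xs ys :: "'n list" where len: "length xs = CARD('n)" "length ys = CARD('n)"
    and dist: "distinct xs" "distinct ys"
    and card: "\<And>i. i \<le> CARD('n) \<Longrightarrow>
      int (card (set (take i xs) \<inter> set (take i ys))) = int i - snd (path_vertex p i)"
    by auto
  let ?F = "coordinate_flag xs :: ('a ^ 'n) set list"
  let ?F' = "coordinate_flag ys :: ('a ^ 'n) set list"
  have "distance_vector ?F ?F' = path_heights p"
    by (intro nth_equalityI)
       (auto simp: distance_vector_def coordinate_flag_def path_heights_def len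
          motzkin_path_length[OF p] injection_dist_def coordinate_space_Int dim_coordinate_space
          card distinct_card dist)
  then show thesis
    using that coordinate_flag_mem[OF dist(1) len(1)] coordinate_flag_mem[OF dist(2) len(2)] by blast
qed

section \<open>Equality of the two counts\<close>

theorem corollary4p19:
  fixes C :: "('a::{field,finite} ^ 'n) set list set"
  assumes "CARD('n) \<ge> 2"
    and "full_flag_code C"
  shows "card (distance_vectors TYPE('a ^ 'n) (min_dist C))
       = motzkin_area_count CARD('n) (min_dist C)"
proof -
  let ?P = "{p \<in> motzkin_paths CARD('n). path_area p = real_of_int (min_dist C)}"
  have P: "?P = {p \<in> motzkin_paths CARD('n). sum_list (path_heights p) = min_dist C}"
    using path_area_eq_sum_heights by auto
  \<comment> \<open>Flag distance is the sum of the distance vector and area the sum of the heights,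
    so the two realisation lemmas match the vectors and paths with the same total.\<close>
  have "distance_vectors TYPE('a ^ 'n) (min_dist C) = path_heights ` ?P"
    unfolding P
  proof (intro equalityI subsetI)
    fix v assume "v \<in> distance_vectors TYPE('a ^ 'n) (min_dist C)"
    then obtain F F' :: "('a ^ 'n) set list" where F: "F \<in> full_flags" "F' \<in> full_flags"
      "flag_dist F F' = min_dist C" "v = distance_vector F F'"
      by (auto simp: distance_vectors_def)
    then obtain p where "p \<in> motzkin_paths CARD('n)" "path_heights p = distance_vector F F'"
      using motzkin_path_of_flags by blast
    with F show "v \<in> path_heights ` {p \<in> motzkin_paths CARD('n). sum_list (path_heights p) = min_dist C}"
      by (auto simp: flag_dist_def intro!: image_eqI[of _ _ p])
  next
    fix v assume "v \<in> path_heights ` {p \<in> motzkin_paths CARD('n). sum_list (path_heights p) = min_dist C}"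
    then obtain p where p: "p \<in> motzkin_paths CARD('n)" "sum_list (path_heights p) = min_dist C"
      "v = path_heights p" by auto
    then obtain F F' :: "('a ^ 'n) set list"
      where "F \<in> full_flags" "F' \<in> full_flags" "distance_vector F F' = path_heights p"
      using flags_of_motzkin_path by blast
    with p show "v \<in> distance_vectors TYPE('a ^ 'n) (min_dist C)"
      unfolding distance_vectors_def flag_dist_def mem_Collect_eq by metis
  qed
  moreover have "inj_on path_heights ?P"
    using inj_on_path_heights by (rule inj_on_subset) auto
  ultimately show ?thesis
    by (simp add: motzkin_area_count_def card_image)
qed

end
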